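(* Let $A\subset\mathbb{N}$ be a finite set of positive integers and let $\alpha>0$. If $|A^2|<\alpha|A|$, then $$|2A|>36^{-\alpha}|A|^2,$$ and for every integer $h\ge 2$, $$|hA|>c_h(\alpha)|A|^h,\qquad\text{where } c_h(\alpha)=(2h^2-h)^{-h\alpha}.$$
   Context: For finite sets $A,B$ of integers, $A+B=\{a+b: a\in A, b\in B\}$ and $hA=A+\cdots+A$ ($h$-fold sum); $AB=\{ab: a\in A,b\in B\}$ and $A^2=AA$ is the product set. *)

theory Defs
  imports Complex_Main "HOL-Library.Set_Algebras"
begin

definition hfold_sumset :: "nat \<Rightarrow> 'a::comm_monoid_add set \<Rightarrow> 'a set"
  where "hfold_sumset h A = (\<Sum>i<h. A)"
  \<comment> \<open>Addition of sets is the pointwise one of Set_Algebras, so this is \<open>A + \<dots> + A\<close>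
      with \<open>h\<close> summands (and \<open>{0}\<close> for \<open>h = 0\<close>), not the dilate of \<open>A\<close> by \<open>h\<close>.\<close>

end

theory Submission
  imports Defs "HOL-Computational_Algebra.Primes" "HOL-Analysis.Convex"
begin

text \<open>
  Identify a positive integer with its vector of prime exponents; then \<open>A * A\<close> is a sumset of
  vectors, and Freiman's lemma bounds the affine rank of \<open>A\<close> by \<open>\<alpha>\<close> (unless \<open>A\<close> is so small that
  \<open>|hA| \<ge> |A|\<close> already suffices). Hence fewer than \<open>\<alpha>\<close> primes have valuations that separate the
  points of \<open>A\<close>. For a single prime \<open>p\<close>, every solution of \<open>a\<^sub>1 + \<dots> + a\<^sub>h = b\<^sub>1 + \<dots> + b\<^sub>h\<close>
  has two terms of equal \<open>p\<close>-adic valuation, so by Hoelder's inequality the squared \<open>L\<^bsup>2h\<^esup>\<close> norm of the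
  exponential sum over \<open>A\<close> is at most \<open>(2h choose 2) = 2h\<^sup>2 - h\<close> times the sum of the squared norms over the
  \<open>p\<close>-adic fibres. Iterating over the separating primes bounds the number of solutions by
  \<open>(2h\<^sup>2 - h)\<^bsup>h\<alpha>\<^esup> |A|\<^sup>h\<close>, and Cauchy--Schwarz turns this into a lower bound for \<open>|hA|\<close>.
  Exponential sums are taken over \<open>\<int>/N\<close> with \<open>N\<close> so large that congruence mod \<open>N\<close> is equality.
\<close>

section \<open>Freiman's lemma for exponent vectors\<close>

inductive_set zspan :: "('i \<Rightarrow> int) set \<Rightarrow> ('i \<Rightarrow> int) set" for X where
  zero: "(\<lambda>_. 0) \<in> zspan X"
| base: "x \<in> X \<Longrightarrow> x \<in> zspan X"
| add: "f \<in> zspan X \<Longrightarrow> g \<in> zspan X \<Longrightarrow> (\<lambda>i. f i + g i) \<in> zspan X"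
| scale: "f \<in> zspan X \<Longrightarrow> (\<lambda>i. c * f i) \<in> zspan X"

lemma zspan_diff:
  assumes "f \<in> zspan X" "g \<in> zspan X"
  shows "(\<lambda>i. f i - g i) \<in> zspan X"
  using zspan.add[OF assms(1) zspan.scale[OF assms(2), of "-1"]] by simp

lemma zspan_subset_zspan:
  assumes "X \<subseteq> zspan Y"
  shows "zspan X \<subseteq> zspan Y"
proof
  fix f assume "f \<in> zspan X"
  then show "f \<in> zspan Y"
    by induction (use assms in \<open>auto intro: zspan.intros\<close>)
qed

lemma zspan_insertE:
  assumes "f \<in> zspan (insert x X)"
  obtains g c where "g \<in> zspan X" "f = (\<lambda>i. g i + c * x i)"
proof -
  from assms have "\<exists>g\<in>zspan X. \<exists>c. f = (\<lambda>i. g i + c * x i)"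
  proof induction
    case zero
    show ?case
      by (rule bexI[OF _ zspan.zero], rule exI[of _ 0]) auto
  next
    case (base y)
    show ?case
    proof (cases "y = x")
      case True
      then show ?thesis
        by (intro bexI[OF _ zspan.zero] exI[of _ 1]) auto
    next
      case False
      with base have "y \<in> zspan X" by (auto intro: zspan.base)
      then show ?thesis
        by (intro bexI[of _ y] exI[of _ 0]) auto
    qed
  next
    case (add f1 f2)
    then obtain g1 c1 g2 c2 where g: "g1 \<in> zspan X" "g2 \<in> zspan X"
      and f: "f1 = (\<lambda>i. g1 i + c1 * x i)" "f2 = (\<lambda>i. g2 i + c2 * x i)"
      by blast
    show ?case unfolding f
      by (intro bexI[OF _ zspan.add[OF g]] exI[of _ "c1 + c2"]) (auto simp: algebra_simps)
  next
    case (scale f1 k)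
    then obtain g1 c1 where g: "g1 \<in> zspan X" and f: "f1 = (\<lambda>i. g1 i + c1 * x i)"
      by blast
    show ?case unfolding f
      by (intro bexI[OF _ zspan.scale[OF g, of k]] exI[of _ "k * c1"]) (auto simp: algebra_simps)
  qed
  then show ?thesis using that by blast
qed

text \<open>Evaluation at \<open>P\<close> is injective on the span. The least size of such a
  \<open>P\<close> is the rank of \<open>X\<close>, so "rank at least \<open>d\<close>" becomes a
  lower bound on every finite determining \<open>P\<close>.\<close>

definition determines :: "'i set \<Rightarrow> ('i \<Rightarrow> int) set \<Rightarrow> bool" where
  "determines P X \<longleftrightarrow> (\<forall>f\<in>zspan X. (\<forall>i\<in>P. f i = 0) \<longrightarrow> (\<forall>i. f i = 0))"

lemma determines_subset_zspan:
  assumes "determines P Y" "X \<subseteq> zspan Y"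
  shows "determines P X"
  using assms zspan_subset_zspan[of X Y] unfolding determines_def by blast

text \<open>If some nonzero \<open>y\<close> of the larger span vanishes on \<open>P\<close>, any
  coordinate \<open>q\<close> with \<open>y q\<close> nonzero repairs this: all vectors vanishing on
  \<open>P\<close> are proportional to \<open>y\<close>.\<close>

lemma determines_insert:
  assumes "determines P X" "finite P"
  obtains Q where "finite Q" "card Q \<le> Suc (card P)" "determines Q (insert x X)"
proof (cases "determines P (insert x X)")
  case True
  then show ?thesis using that[of P] assms by auto
next
  case False
  then obtain y q where y: "y \<in> zspan (insert x X)" "\<And>i. i \<in> P \<Longrightarrow> y i = 0" and q: "y q \<noteq> 0"
    unfolding determines_def by blast
  obtain gy cy where gy: "gy \<in> zspan X" "y = (\<lambda>i. gy i + cy * x i)"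
    using y(1) by (rule zspan_insertE)
  have "cy \<noteq> 0"
  proof
    assume "cy = 0"
    then have "y = gy" using gy by simp
    then show False using gy y q assms(1) unfolding determines_def by blast
  qed
  have "determines (insert q P) (insert x X)"
    unfolding determines_def
  proof (intro ballI impI)
    fix z assume z: "z \<in> zspan (insert x X)" "\<forall>i\<in>insert q P. z i = 0"
    obtain gz cz where gz: "gz \<in> zspan X" "z = (\<lambda>i. gz i + cz * x i)"
      using z(1) by (rule zspan_insertE)
    \<comment> \<open>Cross-multiplication cancels \<open>x\<close> over the integers, so
      \<open>w\<close> falls into the old span, where \<open>P\<close> decides.\<close>
    define w where "w = (\<lambda>i. cy * gz i - cz * gy i)"
    have w: "w \<in> zspan X"
      unfolding w_def using gy gz by (intro zspan_diff zspan.scale)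
    have w': "w i = cy * z i - cz * y i" for i
      unfolding w_def gy(2) gz(2) by (simp add: algebra_simps)
    have "\<forall>i\<in>P. w i = 0" using y(2) z(2) w' by simp
    then have w0: "w i = 0" for i using w assms(1) unfolding determines_def by blast
    have "cz = 0" using w0[of q] w'[of q] z(2) q by simp
    then show "\<forall>i. z i = 0" using w0 w' \<open>cy \<noteq> 0\<close> by simp
  qed
  moreover have "card (insert q P) \<le> Suc (card P)"
    using assms(2) by (simp add: card_insert_if)
  ultimately show ?thesis using that[of "insert q P"] assms(2) by simp
qed

lemma determines_finite:
  assumes "finite X"
  obtains P where "finite P" "card P \<le> card X" "determines P X"
proof -
  from assms have "\<exists>P. finite P \<and> card P \<le> card X \<and> determines P X"
  proof (induction X)
    case empty
    have "f i = 0" if "f \<in> zspan {}" for f :: "'a \<Rightarrow> int" and i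
      using that by induction auto
    then show ?case by (intro exI[of _ "{}"]) (simp add: determines_def)
  next
    case (insert x X)
    then obtain P where P: "finite P" "card P \<le> card X" "determines P X" by blast
    obtain Q where "finite Q" "card Q \<le> Suc (card P)" "determines Q (insert x X)"
      using determines_insert[OF P(3,1)] .
    then show ?case using P insert.hyps by (intro exI[of _ Q]) auto
  qed
  then show ?thesis using that by blast
qed

section \<open>Exponent vectors and product sets\<close>

definition expvec :: "nat \<Rightarrow> nat \<Rightarrow> int" where
  "expvec a p = (if prime p then int (multiplicity p a) else 0)"

lemma expvec_mult:
  assumes "a > 0" "b > 0"
  shows "expvec (a * b) p = expvec a p + expvec b p"
  using assms by (simp add: expvec_def prime_elem_multiplicity_mult_distrib)

lemma expvec_inj:
  assumes "a > 0" "b > 0" "\<And>p. expvec a p = expvec b p"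
  shows "a = b"
proof (rule multiplicity_eq_nat)
  fix p :: nat assume "prime p"
  then show "multiplicity p a = multiplicity p b"
    using assms(3)[of p] by (simp add: expvec_def)
qed (use assms in auto)

text \<open>These span the direction space of the affine hull of the exponent vectors, so their rank
  is the affine rank of \<open>A\<close>.\<close>

definition expdiffs :: "nat set \<Rightarrow> (nat \<Rightarrow> int) set" where
  "expdiffs A = (\<lambda>(x, y) p. expvec x p - expvec y p) ` (A \<times> A)"

lemma expdiffsI: "x \<in> A \<Longrightarrow> y \<in> A \<Longrightarrow> (\<lambda>p. expvec x p - expvec y p) \<in> expdiffs A"
  unfolding expdiffs_def by (rule image_eqI[of _ _ "(x, y)"]) auto

lemma expdiffs_subset_zspan:
  assumes "\<And>x. x \<in> A \<Longrightarrow> (\<lambda>p. expvec x p - expvec a p) \<in> zspan X"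
  shows "expdiffs A \<subseteq> zspan X"
proof
  fix f assume "f \<in> expdiffs A"
  then obtain x y where "x \<in> A" "y \<in> A" and f: "f = (\<lambda>p. expvec x p - expvec y p)"
    unfolding expdiffs_def by auto
  then show "f \<in> zspan X"
    using zspan_diff[OF assms assms, of x y] by simp
qed

text \<open>Freiman's lemma, by removing the least element \<open>a\<close> of \<open>A\<close>. The elements \<open>x\<close> with
  \<open>a * x \<notin> A' * A'\<close> span the exponent differences, since \<open>a * x = y * z\<close> forces \<open>y, z < x\<close>; so
  there are at least \<open>d\<close> new products. If removing \<open>a\<close> lowers the rank, then \<open>a\<close> is not in the
  affine span of \<open>A'\<close> and all products \<open>a * x\<close> are new.\<close>

theorem Freiman_multiplicative:
  assumes "finite A" "A \<noteq> {}" "\<forall>a\<in>A. 0 < a"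
    and "\<And>P. finite P \<Longrightarrow> determines P (expdiffs A) \<Longrightarrow> d \<le> card P"
  shows "2 * (d + 1) * card A \<le> 2 * card (A * A) + d * (d + 1)"
  using assms
\<comment> \<open>\<open>d\<close> stays arbitrary because deleting \<open>a\<close> may lower the
  rank by one. The inequality is |AA| \<ge> (d+1)|A| - d(d+1)/2, freed of subtraction and
  fractions.\<close>
proof (induction A arbitrary: d rule: finite_linorder_min_induct)
  case empty
  then show ?case by simp
next
  case (insert a A')
  let ?A = "insert a A'"
  let ?D = "\<lambda>x y p. expvec x p - expvec y p"
  have fin: "finite A'" and less: "\<And>x. x \<in> A' \<Longrightarrow> a < x" and a0: "a > 0"
    and pos: "\<And>x. x \<in> A' \<Longrightarrow> x > 0"
    using insert by auto
  have aA': "a \<notin> A'" using less by blast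
  have finAA: "finite (?A * ?A)" using fin by (intro finite_set_times) auto
  have sub0: "A' * A' \<subseteq> ?A * ?A" by (intro set_times_mono2) auto
  show ?case
  proof (cases "A' = {}")
    case True
    \<comment> \<open>A single point has rank 0, which forces \<open>d = 0\<close>.\<close>
    have "determines {} (expdiffs {a})"
      by (rule determines_subset_zspan[of _ "{}"])
        (auto simp: determines_def expdiffs_def intro: zspan.zero elim: zspan.induct)
    then have "d = 0" using insert.prems(3)[of "{}"] True by simp
    then show ?thesis using True by (simp add: set_times_image)
  next
    case False
    define I where "I = {x \<in> A'. a * x \<notin> A' * A'}"
    have finI: "finite I" using fin by (simp add: I_def)
    have sp: "?D x a \<in> zspan ((\<lambda>y. ?D y a) ` I)" if "x \<in> A'" for x
      using that
    proof (induction x rule: less_induct)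
      case (less x)
      show ?case
      proof (cases "x \<in> I")
        case True
        then show ?thesis by (intro zspan.base) auto
      next
        case False
        then obtain y z where yz: "y \<in> A'" "z \<in> A'" "a * x = y * z"
          using less.prems unfolding I_def by (auto elim: set_times_elim)
        have ay: "a < y" "a < z" using yz \<open>\<And>x. x \<in> A' \<Longrightarrow> a < x\<close> by auto
        have "y < x"
        proof (rule ccontr)
          assume "\<not> y < x"
          then have "a * x \<le> a * y" by simp
          also have "\<dots> < z * y" using ay a0 by simp
          finally show False using yz by (simp add: mult.commute)
        qed
        moreover have "z < x"
        proof (rule ccontr)
          assume "\<not> z < x"
          then have "a * x \<le> a * z" by simp
          also have "\<dots> < y * z" using ay a0 by simp
          finally show False using yz by simp
        qed
        moreover have "?D x a = (\<lambda>p. ?D y a p + ?D z a p)"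
        proof
          fix p
          have "expvec a p + expvec x p = expvec y p + expvec z p"
            using yz expvec_mult[of a x p] expvec_mult[of y z p] a0 pos less.prems by simp
          then show "?D x a p = ?D y a p + ?D z a p" by simp
        qed
        ultimately show ?thesis
          using zspan.add[OF less.IH less.IH, of y z] yz by (simp only:)
      qed
    qed
    have "?D x a \<in> zspan ((\<lambda>y. ?D y a) ` I)" if "x \<in> ?A" for x
      using that sp zspan.zero by auto
    then have sp': "expdiffs ?A \<subseteq> zspan ((\<lambda>y. ?D y a) ` I)"
      by (rule expdiffs_subset_zspan)
    obtain P where P: "finite P" "card P \<le> card ((\<lambda>y. ?D y a) ` I)" "determines P ((\<lambda>y. ?D y a) ` I)"
      using determines_finite[OF finite_imageI[OF finI]] .
    have "d \<le> card P"
      using P sp' by (intro insert.prems(3)) (auto intro: determines_subset_zspan)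
    also have "\<dots> \<le> card I" using P(2) card_image_le[OF finI] by (rule order_trans)
    finally have dI: "d \<le> card I" .
    have new: "card (A' * A') + card J \<le> card (?A * ?A)"
      if J: "J \<subseteq> ?A" "\<And>x. x \<in> J \<Longrightarrow> a * x \<notin> A' * A'" for J
    proof -
      have "finite J" using J(1) fin finite_subset by blast
      have "card (A' * A') + card J = card (A' * A') + card ((*) a ` J)"
        using a0 by (subst card_image) (auto simp: inj_on_def)
      also have "\<dots> = card (A' * A' \<union> (*) a ` J)"
        using J \<open>finite J\<close> fin by (subst card_Un_disjoint) (auto intro: finite_set_times)
      also have "\<dots> \<le> card (?A * ?A)"
        using J sub0 by (intro card_mono finAA) (auto intro: set_times_intro)
      finally show ?thesis .
    qed
    have aa: "a * a \<notin> A' * A'"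
    proof
      assume "a * a \<in> A' * A'"
      then obtain y z where "y \<in> A'" "z \<in> A'" "a * a = y * z" by (auto elim: set_times_elim)
      moreover from this have "a * a < y * z" using less pos by (intro mult_strict_mono) auto
      ultimately show False by simp
    qed
    show ?thesis
    proof (cases "\<forall>P. finite P \<longrightarrow> determines P (expdiffs A') \<longrightarrow> d \<le> card P")
      case True
      then have IH: "2 * (d + 1) * card A' \<le> 2 * card (A' * A') + d * (d + 1)"
        using False pos by (intro insert.IH) auto
      \<comment> \<open>The square \<open>a * a\<close> joins the at least \<open>d\<close> products
        from \<open>I\<close>; \<open>d + 1\<close> new products pay for the growth of the left side
        by \<open>2 * (d + 1)\<close>.\<close>
      have "card (A' * A') + card (insert a I) \<le> card (?A * ?A)"
        using aa by (intro new) (auto simp: I_def)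
      moreover have "card (insert a I) = card I + 1"
        using finI aA' by (simp add: I_def)
      ultimately have "card (A' * A') + (d + 1) \<le> card (?A * ?A)" using dI by linarith
      then show ?thesis using IH fin aA' by (simp add: algebra_simps)
    next
      case lower: False
      then obtain P where P: "finite P" "determines P (expdiffs A')" "card P < d"
        by (simp only: not_all not_imp not_le) blast
      obtain b where b: "b \<in> A'" using False by blast
      have ext: "expdiffs ?A \<subseteq> zspan X"
        if X: "expdiffs A' \<subseteq> zspan X" "?D a b \<in> zspan X" for X
      proof (rule expdiffs_subset_zspan[where a = b])
        fix x assume "x \<in> ?A"
        then show "?D x b \<in> zspan X"
          using X b expdiffsI[of x A' b] by auto
      qed
      \<comment> \<open>Adjoining \<open>a\<close> adds the one generator \<open>?D a b\<close>, so
        the rank drops by at most one and induction applies with \<open>d - 1\<close>.\<close>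
      have d1: "d - 1 \<le> card Q" if Q: "finite Q" "determines Q (expdiffs A')" for Q
      proof -
        obtain R where R: "finite R" "card R \<le> Suc (card Q)"
          "determines R (insert (?D a b) (expdiffs A'))"
          using determines_insert[OF Q(2,1)] .
        have "expdiffs ?A \<subseteq> zspan (insert (?D a b) (expdiffs A'))"
          by (rule ext) (auto intro: zspan.base)
        then have "d \<le> card R" using R by (intro insert.prems(3)) (auto intro: determines_subset_zspan)
        then show ?thesis using R by linarith
      qed
      have IH: "2 * (d - 1 + 1) * card A' \<le> 2 * card (A' * A') + (d - 1) * (d - 1 + 1)"
        using False pos d1 by (intro insert.IH) auto
      \<comment> \<open>An old product \<open>a * x = y * z\<close> would put \<open>?D a b\<close>
        into the span of the differences of \<open>A'\<close>; then \<open>P\<close>, too small for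
        \<open>A\<close>, would determine them all.\<close>
      have "a * x \<notin> A' * A'" if "x \<in> ?A" for x
      proof (cases "x = a")
        case True
        then show ?thesis using aa by simp
      next
        case False
        then have x: "x \<in> A'" using that by simp
        show ?thesis
        proof
          assume "a * x \<in> A' * A'"
          then obtain y z where yz: "y \<in> A'" "z \<in> A'" "a * x = y * z" by (auto elim: set_times_elim)
          have "?D a b = (\<lambda>p. ?D y x p + ?D z b p)"
          proof
            fix p
            have "expvec a p + expvec x p = expvec y p + expvec z p"
              using yz expvec_mult[of a x p] expvec_mult[of y z p] a0 pos x by simp
            then show "?D a b p = ?D y x p + ?D z b p" by simp
          qed
          moreover have "(\<lambda>p. ?D y x p + ?D z b p) \<in> zspan (expdiffs A')"
            using yz x b by (intro zspan.add zspan.base expdiffsI)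
          ultimately have "expdiffs ?A \<subseteq> zspan (expdiffs A')"
            by (intro ext) (auto intro: zspan.base)
          then have "d \<le> card P"
            using P by (intro insert.prems(3)) (auto intro: determines_subset_zspan)
          then show False using P(3) by simp
        qed
      qed
      \<comment> \<open>These \<open>card A' + 1\<close> new products lift the bound for
        \<open>d - 1\<close> to the one for \<open>d\<close>: the deficit \<open>2 * d\<close> is
        \<open>d * (d + 1) - (d - 1) * d\<close>.\<close>
      then have "card (A' * A') + card ?A \<le> card (?A * ?A)" by (intro new) auto
      moreover obtain d' where "d = Suc d'" using P(3) by (cases d) auto
      ultimately show ?thesis using IH fin aA' by (simp add: algebra_simps)
    qed
  qed
qed

section \<open>Moments of exponential sums\<close>

text \<open>A geometric sum over an \<open>N\<close>-th root of unity. The bound on \<open>m\<close>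
  turns divisibility by \<open>N\<close> into \<open>m = 0\<close>.\<close>

lemma sum_cis_orthogonal:
  fixes m :: int
  assumes "\<bar>m\<bar> < int N"
  shows "(\<Sum>t<N. cis (2 * pi * real t * of_int m / real N)) = (if m = 0 then of_nat N else 0)"
proof (cases "m = 0")
  case False
  have N: "N > 0" using assms by linarith
  define z where "z = cis (2 * pi * of_int m / real N)"
  have zt: "z ^ t = cis (2 * pi * real t * of_int m / real N)" for t
    unfolding z_def DeMoivre by (simp add: mult_ac)
  have "z \<noteq> 1"
  proof
    assume "z = 1"
    then have "cos (2 * pi * of_int m / real N) = 1"
      unfolding z_def by (simp add: complex_eq_iff)
    then obtain k :: int where "2 * pi * of_int m / real N = of_int k * 2 * pi"
      unfolding cos_one_2pi_int by blast
    then have "real_of_int m = real_of_int (k * int N)"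
      using N by (simp add: field_simps)
    then have "m = k * int N" by linarith
    then have "\<bar>m\<bar> = \<bar>k\<bar> * int N" by (simp add: abs_mult)
    moreover have "\<bar>k\<bar> \<ge> 1" using False \<open>m = k * int N\<close> by (cases "k = 0") auto
    ultimately have "\<bar>m\<bar> \<ge> int N"
      using mult_right_mono[of 1 "\<bar>k\<bar>" "int N"] by simp
    then show False using assms by simp
  qed
  moreover have "z ^ N = 1"
  proof -
    have "z ^ N = cis (2 * pi * of_int m)"
      unfolding zt using N by (intro arg_cong[where f = cis]) simp
    also have "\<dots> = 1" by (simp add: complex_eq_iff cos_int_2pin sin_int_2pin)
    finally show ?thesis .
  qed
  ultimately have "(\<Sum>t<N. z ^ t) = 0" by (simp add: geometric_sum)
  then show ?thesis using False by (simp add: zt)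
qed simp

text \<open>Hoelder with exponents \<open>h\<close> and \<open>h / (h - 1)\<close>: Young's
  inequality is summed after both power sums are normalised to 1. Later \<open>u\<close> and
  \<open>v\<close> are squared moduli of the exponential sums of a fibre and of the whole
  set.\<close>

lemma Holder_sum_power:
  fixes u v :: "'a \<Rightarrow> real"
  assumes fin: "finite T" and u: "\<And>t. t \<in> T \<Longrightarrow> u t \<ge> 0" and v: "\<And>t. t \<in> T \<Longrightarrow> v t \<ge> 0"
    and h: "h \<ge> 2"
  shows "(\<Sum>t\<in>T. u t * v t ^ (h - 1))
    \<le> (\<Sum>t\<in>T. u t ^ h) powr (1 / h) * (\<Sum>t\<in>T. v t ^ h) powr (1 - 1 / h)"
proof -
  define U V where "U = (\<Sum>t\<in>T. u t ^ h)" and "V = (\<Sum>t\<in>T. v t ^ h)"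
  have nn: "U \<ge> 0" "V \<ge> 0" unfolding U_def V_def using u v by (auto intro: sum_nonneg)
  show ?thesis
  \<comment> \<open>The normalisation divides by \<open>U\<close> and \<open>V\<close>; if either is
    0, every summand vanishes.\<close>
  proof (cases "U = 0 \<or> V = 0")
    case True
    have "u t * v t ^ (h - 1) = 0" if "t \<in> T" for t
    proof -
      have "u t ^ h = 0 \<or> v t ^ h = 0"
        using True fin u v that unfolding U_def V_def
        by (subst (asm) (1 2) sum_nonneg_eq_0_iff) auto
      then show ?thesis using h by auto
    qed
    then have "(\<Sum>t\<in>T. u t * v t ^ (h - 1)) = 0" by (simp add: sum.neutral)
    then show ?thesis by (simp only:) simp
  next
    case False
    then have pos: "U > 0" "V > 0" using nn by auto
    have Young: "u t * v t ^ (h - 1)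
      \<le> U powr (1 / h) * V powr (1 - 1 / h) * (1 / h * (u t ^ h / U) + (1 - 1 / h) * (v t ^ h / V))"
      if t: "t \<in> T" for t
    proof (cases "u t = 0 \<or> v t = 0")
      case True
      then show ?thesis using h pos u[OF t] v[OF t] by (auto simp: power_0_left)
    next
      case False
      then have uv: "u t > 0" "v t > 0" using u[OF t] v[OF t] by auto
      have u1: "(u t ^ h) powr (1 / h) = u t"
        using uv h by (simp add: powr_powr flip: powr_realpow)
      have v1: "(v t ^ h) powr (1 - 1 / h) = v t ^ (h - 1)"
      proof -
        have "real h * (1 - 1 / real h) = real (h - 1)" using h by (simp add: field_simps of_nat_diff)
        then show ?thesis using uv by (simp add: powr_powr del: of_nat_diff flip: powr_realpow)
      qed
      have "(u t ^ h / U) powr (1 / h) * (v t ^ h / V) powr (1 - 1 / h)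
        \<le> 1 / h * (u t ^ h / U) + (1 - 1 / h) * (v t ^ h / V)"
        using uv pos h by (intro Youngs_inequality_0) auto
      also have "(u t ^ h / U) powr (1 / h) * (v t ^ h / V) powr (1 - 1 / h)
        = u t * v t ^ (h - 1) / (U powr (1 / h) * V powr (1 - 1 / h))"
        using uv pos by (simp add: powr_divide u1 v1)
      finally show ?thesis using pos by (simp add: divide_le_eq mult.commute)
    qed
    have "(\<Sum>t\<in>T. u t * v t ^ (h - 1))
      \<le> (\<Sum>t\<in>T. U powr (1 / h) * V powr (1 - 1 / h) * (1 / h * (u t ^ h / U) + (1 - 1 / h) * (v t ^ h / V)))"
      by (intro sum_mono Young)
    also have "\<dots> = U powr (1 / h) * V powr (1 - 1 / h) * (1 / h * (U / U) + (1 - 1 / h) * (V / V))"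
      unfolding sum_distrib_left[symmetric] sum.distrib sum_divide_distrib[symmetric]
        U_def[symmetric] V_def[symmetric] ..
    also have "\<dots> = U powr (1 / h) * V powr (1 - 1 / h)" using pos by simp
    finally show ?thesis unfolding U_def V_def .
  qed
qed

section \<open>Counting solutions by exponential sums\<close>

definition expsum :: "nat \<Rightarrow> nat set \<Rightarrow> nat \<Rightarrow> complex" where
  "expsum N B t = (\<Sum>a\<in>B. cis (2 * pi * real t * real a / real N))"

text \<open>The \<open>2h\<close>-th power of the \<open>L^(2h)\<close> norm over the integers mod
  \<open>N\<close>, not divided by \<open>N\<close>.\<close>

definition moment :: "nat \<Rightarrow> nat \<Rightarrow> nat set \<Rightarrow> real" where
  "moment N h B = (\<Sum>t<N. norm (expsum N B t) ^ (2 * h))"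

definition possign :: "nat \<Rightarrow> nat \<Rightarrow> int" where
  "possign h i = (if i < h then 1 else - 1)"

text \<open>Both sides of the equation form one signed tuple, so coincidences within a side and
  across sides are treated alike. \<open>B\<close> varies with the position since two entries will
  be confined to a fibre.\<close>

definition solutions :: "nat \<Rightarrow> (nat \<Rightarrow> nat set) \<Rightarrow> (nat \<Rightarrow> nat) set" where
  "solutions h B = {f \<in> PiE {..<2 * h} B. (\<Sum>i<2 * h. possign h i * int (f i)) = 0}"

lemma finite_solutions: "(\<And>i. finite (B i)) \<Longrightarrow> finite (solutions h B)"
  unfolding solutions_def by (simp add: finite_PiE)

lemma cis_sum: "finite I \<Longrightarrow> (\<Prod>i\<in>I. cis (x i)) = cis (\<Sum>i\<in>I. x i)"
  by (induction I rule: finite_induct) (auto simp: cis_mult)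

lemma expsum_cnj: "cnj (expsum N B t) = (\<Sum>a\<in>B. cis (- (2 * pi * real t * real a / real N)))"
  unfolding expsum_def by (simp add: cis_cnj)

text \<open>Expanding the product gives one character per tuple, conjugates supplying the minus
  signs; summing over \<open>t\<close> keeps the tuples with vanishing signed sum.\<close>

lemma card_solutions_eq:
  assumes fin: "\<And>i. finite (B i)" and bd: "\<And>i a. a \<in> B i \<Longrightarrow> 2 * h * a < N" and h: "h > 0"
  shows "of_nat N * of_nat (card (solutions h B))
    = (\<Sum>t<N. \<Prod>i<2 * h. if i < h then expsum N (B i) t else cnj (expsum N (B i) t))"
proof -
  let ?S = "\<lambda>f. \<Sum>i<2 * h. possign h i * int (f i)"
  have eq: "(if i < h then expsum N (B i) t else cnj (expsum N (B i) t))
    = (\<Sum>a\<in>B i. cis (2 * pi * real t * of_int (possign h i * int a) / real N))" for i t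
    by (simp add: expsum_cnj possign_def) (simp add: expsum_def)
  have "(\<Sum>t<N. \<Prod>i<2 * h. if i < h then expsum N (B i) t else cnj (expsum N (B i) t))
    = (\<Sum>t<N. \<Sum>f\<in>PiE {..<2 * h} B. \<Prod>i<2 * h. cis (2 * pi * real t * of_int (possign h i * int (f i)) / real N))"
    unfolding eq using fin by (intro sum.cong refl prod_sum_PiE) auto
  also have "\<dots> = (\<Sum>t<N. \<Sum>f\<in>PiE {..<2 * h} B. cis (2 * pi * real t * of_int (?S f) / real N))"
    by (subst cis_sum) (simp_all add: sum_distrib_left sum_divide_distrib)
  also have "\<dots> = (\<Sum>f\<in>PiE {..<2 * h} B. \<Sum>t<N. cis (2 * pi * real t * of_int (?S f) / real N))"
    by (rule sum.swap)
  also have "\<dots> = (\<Sum>f\<in>PiE {..<2 * h} B. if ?S f = 0 then of_nat N else 0)"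
  proof (intro sum.cong refl sum_cis_orthogonal)
    fix f assume f: "f \<in> PiE {..<2 * h} B"
    have "int (2 * h) * \<bar>?S f\<bar> \<le> int (2 * h) * (\<Sum>i<2 * h. int (f i))"
      by (intro mult_left_mono order_trans[OF sum_abs] sum_mono) (auto simp: possign_def)
    also have "\<dots> = (\<Sum>i<2 * h. int (2 * h * f i))" by (simp add: sum_distrib_left)
    also have "\<dots> < (\<Sum>i<2 * h. int N)"
    proof (rule sum_strict_mono)
      fix i assume "i \<in> {..<2 * h}"
      then have "2 * h * f i < N" using f by (intro bd[of _ i]) auto
      then show "int (2 * h * f i) < int N" by (simp only: of_nat_less_iff)
    qed (use h in \<open>auto simp: lessThan_empty_iff\<close>)
    also have "\<dots> = int (2 * h) * int N" by simp
    finally show "\<bar>?S f\<bar> < int N" using h by (simp only: mult_less_cancel_left)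
  qed
  also have "\<dots> = (\<Sum>f\<in>solutions h B. of_nat N)"
    unfolding solutions_def using fin
    by (intro sum.mono_neutral_cong_right) (auto intro: finite_PiE)
  finally show ?thesis by (simp add: mult.commute)
qed

lemma moment_eq_card_solutions:
  assumes "finite A" "\<And>a. a \<in> A \<Longrightarrow> 2 * h * a < N" "h > 0"
  shows "moment N h A = real N * real (card (solutions h (\<lambda>_. A)))"
proof -
  have prod: "(\<Prod>i<2 * h. if i < h then z else cnj z) = of_real (norm z ^ (2 * h))" for z
  proof -
    have "(\<Prod>i<2 * h. if i < h then z else cnj z) = (\<Prod>i\<in>{..<h} \<union> {h..<2 * h}. if i < h then z else cnj z)"
      by (intro prod.cong) auto
    also have "\<dots> = (\<Prod>i<h. z) * (\<Prod>i\<in>{h..<2 * h}. cnj z)"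
      by (subst prod.union_disjoint) (auto intro!: arg_cong2[where f = "(*)"] prod.cong)
    also have "\<dots> = (z * cnj z) ^ h" by (simp add: power_mult_distrib)
    also have "\<dots> = of_real (norm z ^ (2 * h))"
      by (simp add: complex_norm_square[symmetric] power_mult)
    finally show ?thesis .
  qed
  have "complex_of_real (real N * real (card (solutions h (\<lambda>_. A)))) = of_real (moment N h A)"
    using card_solutions_eq[of "\<lambda>_. A" h N] assms unfolding moment_def prod by simp
  then show ?thesis by (simp only: of_real_eq_iff)
qed

text \<open>With different sets the product need not be real and nonnegative; the triangle
  inequality passes to moduli.\<close>

lemma card_solutions_le:
  assumes "\<And>i. finite (B i)" "\<And>i a. a \<in> B i \<Longrightarrow> 2 * h * a < N" "h > 0"
  shows "real N * real (card (solutions h B)) \<le> (\<Sum>t<N. \<Prod>i<2 * h. norm (expsum N (B i) t))"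
proof -
  have "real N * real (card (solutions h B)) = norm (of_nat N * of_nat (card (solutions h B)) :: complex)"
    by (simp add: norm_mult)
  also have "\<dots> \<le> (\<Sum>t<N. norm (\<Prod>i<2 * h. if i < h then expsum N (B i) t else cnj (expsum N (B i) t)))"
    by (subst card_solutions_eq[of B h N]) (use assms in \<open>auto intro: norm_sum\<close>)
  also have "\<dots> = (\<Sum>t<N. \<Prod>i<2 * h. norm (expsum N (B i) t))"
    by (auto intro!: sum.cong prod.cong simp: prod_norm[symmetric])
  finally show ?thesis .
qed

section \<open>Splitting by the valuation at one prime\<close>

text \<open>In a vanishing signed sum the least valuation cannot be attained only once.\<close>

lemma signed_sum_zero_repeats_valuation:
  fixes f :: "nat \<Rightarrow> nat" and s :: "nat \<Rightarrow> int"
  assumes "n \<ge> 2" and pos: "\<And>i. i < n \<Longrightarrow> f i > 0" and s: "\<And>i. i < n \<Longrightarrow> \<bar>s i\<bar> = 1"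
    and sum: "(\<Sum>i<n. s i * int (f i)) = 0"
  shows "\<exists>k l. k < l \<and> l < n \<and> expvec (f k) p = expvec (f l) p"
proof (cases "prime p")
  case False
  \<comment> \<open>At a non-prime all entries are 0 by convention, so positions 0 and 1
    agree.\<close>
  then show ?thesis using assms(1) by (intro exI[of _ 0] exI[of _ 1]) (auto simp: expvec_def)
next
  case True
  let ?v = "\<lambda>i. multiplicity p (f i)"
  have "finite {..<n}" "{..<n} \<noteq> {}" using assms(1) by (auto simp: lessThan_empty_iff)
  then obtain m where m: "m < n" "\<And>i. i < n \<Longrightarrow> ?v m \<le> ?v i"
    using arg_min_if_finite[of "{..<n}" ?v] by (metis lessThan_iff not_less)
  have "\<exists>i<n. i \<noteq> m \<and> ?v i = ?v m"
  proof (rule ccontr)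
    assume no: "\<not> ?thesis"
    have dvd: "int (p ^ Suc (?v m)) dvd s i * int (f i)" if "i \<in> {..<n} - {m}" for i
    proof -
      have "Suc (?v m) \<le> ?v i" using m(2)[of i] no that by force
      then have "p ^ Suc (?v m) dvd f i" by (rule multiplicity_dvd')
      then show ?thesis by (intro dvd_mult) (simp only: of_nat_dvd_iff)
    qed
    have "s m * int (f m) = - (\<Sum>i\<in>{..<n} - {m}. s i * int (f i))"
      using sum m(1) by (subst (asm) sum.remove[of _ m]) auto
    then have "int (p ^ Suc (?v m)) dvd s m * int (f m)"
      using dvd_sum[OF dvd] by (simp only: dvd_minus_iff)
    then have "int (p ^ Suc (?v m)) dvd int (f m)"
      using s[OF m(1)] by (auto simp: abs_if split: if_splits)
    then have "p ^ Suc (?v m) dvd f m" by (simp only: of_nat_dvd_iff)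
    moreover have "\<not> p ^ Suc (?v m) dvd f m"
      using True pos[OF m(1)] not_prime_unit[of p]
      by (subst power_dvd_iff_le_multiplicity) auto
    ultimately show False by blast
  qed
  then obtain i where i: "i < n" "i \<noteq> m" "?v i = ?v m" by blast
  then have "expvec (f i) p = expvec (f m) p" by (simp add: expvec_def)
  then show ?thesis using m(1) i(1,2) by (metis nat_neq_iff)
qed

text \<open>The number of pairs of positions, which is the base \<open>2h^2 - h\<close> of
  \<open>c_h(\<alpha>)\<close>.\<close>

lemma card_increasing_pairs:
  "card (SIGMA l:{..<2 * h}. {..<l}) = h * (2 * h - 1)"
proof -
  have "2 * (\<Sum>l<n. l) = n * (n - 1)" for n :: nat
  proof (induction n)
    case (Suc n)
    then show ?case by (cases n) (auto simp: algebra_simps)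
  qed simp
  from this[of "2 * h"] show ?thesis by simp
qed

text \<open>A union bound over the pair of positions with equal valuation and over that valuation
  \<open>j\<close>: two factors come from the fibre, the other \<open>2 * h - 2\<close> from
  \<open>A\<close>.\<close>

lemma moment_le_fibres:
  fixes p :: nat
  assumes fin: "finite A" and pos: "\<forall>a\<in>A. 0 < a" and bd: "\<And>a. a \<in> A \<Longrightarrow> 2 * h * a < N"
    and h: "h \<ge> 2"
  defines "Aj \<equiv> \<lambda>j. {a \<in> A. expvec a p = j}"
  shows "moment N h A \<le> (2 * real h ^ 2 - real h) *
    (\<Sum>j\<in>(\<lambda>a. expvec a p) ` A. \<Sum>t<N. norm (expsum N (Aj j) t) ^ 2 * norm (expsum N A t) ^ (2 * h - 2))"
proof -
  define V where "V = (\<lambda>a. expvec a p) ` A"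
  define W where "W = (SIGMA l:{..<2 * h}. {..<l})"
  define B where "B = (\<lambda>(l, k) j (i :: nat). if i = k \<or> i = l then Aj j else A)"
  have BA: "B w j i \<subseteq> A" for w j i by (auto simp: B_def Aj_def split: prod.splits if_splits)
  have finB: "finite (B w j i)" for w j i using BA fin by (rule finite_subset)
  have finV: "finite V" using fin by (simp add: V_def)
  have finW: "finite W" by (simp add: W_def)
  have sub: "solutions h (\<lambda>_. A) \<subseteq> (\<Union>(w, j)\<in>W \<times> V. solutions h (B w j))"
  proof
    fix f assume f: "f \<in> solutions h (\<lambda>_. A)"
    then have fA: "f i \<in> A" if "i < 2 * h" for i using that by (auto simp: solutions_def)
    have "\<exists>k l. k < l \<and> l < 2 * h \<and> expvec (f k) p = expvec (f l) p"
      using f fA pos h by (intro signed_sum_zero_repeats_valuation[where s = "possign h"])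
        (auto simp: solutions_def possign_def)
    then obtain k l where kl: "k < l" "l < 2 * h" "expvec (f k) p = expvec (f l) p" by blast
    have "f \<in> solutions h (B (l, k) (expvec (f l) p))"
      using f fA kl by (auto simp: solutions_def B_def Aj_def PiE_iff)
    moreover have "((l, k), expvec (f l) p) \<in> W \<times> V" using kl fA by (auto simp: W_def V_def)
    ultimately show "f \<in> (\<Union>(w, j)\<in>W \<times> V. solutions h (B w j))" by blast
  qed
  have "card (solutions h (\<lambda>_. A)) \<le> card (\<Union>(w, j)\<in>W \<times> V. solutions h (B w j))"
    using finW finV finB by (intro card_mono sub) (auto intro!: finite_solutions)
  also have "\<dots> \<le> (\<Sum>(w, j)\<in>W \<times> V. card (solutions h (B w j)))"
    using finW finV by (simp only: case_prod_unfold) (rule card_UN_le, simp)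
  finally have "moment N h A \<le> real N * real (\<Sum>(w, j)\<in>W \<times> V. card (solutions h (B w j)))"
    using h by (subst moment_eq_card_solutions[OF fin bd]) (auto intro!: mult_left_mono simp del: of_nat_sum)
  also have "\<dots> = (\<Sum>(w, j)\<in>W \<times> V. real N * real (card (solutions h (B w j))))"
    by (simp add: sum_distrib_left case_prod_unfold)
  also have "\<dots> \<le> (\<Sum>(w, j)\<in>W \<times> V. \<Sum>t<N. norm (expsum N (Aj j) t) ^ 2 * norm (expsum N A t) ^ (2 * h - 2))"
  proof (rule sum_mono, clarify)
    fix l k j assume "(l, k) \<in> W"
    then have kl: "k < l" "l < 2 * h" by (auto simp: W_def)
    have "real N * real (card (solutions h (B (l, k) j))) \<le> (\<Sum>t<N. \<Prod>i<2 * h. norm (expsum N (B (l, k) j i) t))"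
      using finB BA bd h by (intro card_solutions_le) (blast, blast, simp)
    also have "\<dots> = (\<Sum>t<N. norm (expsum N (Aj j) t) ^ 2 * norm (expsum N A t) ^ (2 * h - 2))"
    proof (rule sum.cong[OF refl])
      fix t
      have "(\<Prod>i<2 * h. norm (expsum N (B (l, k) j i) t))
        = (\<Prod>i\<in>insert k (insert l ({..<2 * h} - {k, l})). norm (expsum N (B (l, k) j i) t))"
        using kl by (intro prod.cong) auto
      also have "\<dots> = norm (expsum N (Aj j) t) ^ 2 * (\<Prod>i\<in>{..<2 * h} - {k, l}. norm (expsum N A t))"
        using kl by (simp add: B_def power2_eq_square)
      also have "(\<Prod>i\<in>{..<2 * h} - {k, l}. norm (expsum N A t)) = norm (expsum N A t) ^ (2 * h - 2)"
        using kl by (simp add: card_Diff_subset numeral_2_eq_2)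
      finally show "(\<Prod>i<2 * h. norm (expsum N (B (l, k) j i) t))
        = norm (expsum N (Aj j) t) ^ 2 * norm (expsum N A t) ^ (2 * h - 2)" .
    qed
    finally show "real N * real (card (solutions h (B (l, k) j)))
      \<le> (\<Sum>t<N. norm (expsum N (Aj j) t) ^ 2 * norm (expsum N A t) ^ (2 * h - 2))" .
  qed
  also have "\<dots> = real (card W) *
    (\<Sum>j\<in>V. \<Sum>t<N. norm (expsum N (Aj j) t) ^ 2 * norm (expsum N A t) ^ (2 * h - 2))"
    by (simp add: sum.cartesian_product[symmetric])
  also have "real (card W) = 2 * real h ^ 2 - real h"
    unfolding W_def card_increasing_pairs using h
    by (simp add: of_nat_diff algebra_simps power2_eq_square)
  finally show ?thesis unfolding V_def .
qed

text \<open>Hoelder bounds each fibre term by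
  \<open>moment(fibre)^(1/h) * moment(A)^(1-1/h)\<close>; the second factor is common to all and
  cancels when the moment of \<open>A\<close> is positive.\<close>

lemma moment_root_le_fibres:
  assumes fin: "finite A" and pos: "\<forall>a\<in>A. 0 < a" and bd: "\<And>a. a \<in> A \<Longrightarrow> 2 * h * a < N"
    and h: "h \<ge> 2"
  shows "moment N h A powr (1 / h) \<le> (2 * real h ^ 2 - real h) *
    (\<Sum>j\<in>(\<lambda>a. expvec a p) ` A. moment N h {a \<in> A. expvec a p = j} powr (1 / h))"
    (is "_ \<le> ?c * ?R")
proof -
  have mom: "moment N h B = (\<Sum>t<N. (norm (expsum N B t) ^ 2) ^ h)" for B
    by (simp add: moment_def power_mult)
  have nn: "moment N h B \<ge> 0" for B unfolding mom by (intro sum_nonneg) auto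
  have c: "?c \<ge> 0" using h by (simp add: power2_eq_square mult_le_cancel_right1)
  have R: "?R \<ge> 0" by (intro sum_nonneg) auto
  show ?thesis
  proof (cases "moment N h A = 0")
    case True
    then show ?thesis using c R by simp
  next
    case False
    then have K: "moment N h A > 0" using nn[of A] by simp
    have "moment N h A \<le> ?c * (\<Sum>j\<in>(\<lambda>a. expvec a p) ` A.
      moment N h {a \<in> A. expvec a p = j} powr (1 / h) * moment N h A powr (1 - 1 / h))"
    proof (rule order_trans[OF moment_le_fibres[OF fin pos bd h, of p]])
      have pw: "norm (expsum N A t) ^ (2 * h - 2) = (norm (expsum N A t) ^ 2) ^ (h - 1)" for t
        by (simp add: diff_mult_distrib2 flip: power_mult)
      show "?c * (\<Sum>j\<in>(\<lambda>a. expvec a p) ` A. \<Sum>t<N.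
          norm (expsum N {a \<in> A. expvec a p = j} t) ^ 2 * norm (expsum N A t) ^ (2 * h - 2))
        \<le> ?c * (\<Sum>j\<in>(\<lambda>a. expvec a p) ` A.
          moment N h {a \<in> A. expvec a p = j} powr (1 / h) * moment N h A powr (1 - 1 / h))"
        unfolding mom pw using h c by (intro mult_left_mono sum_mono Holder_sum_power) auto
    qed
    also have "\<dots> = ?c * ?R * moment N h A powr (1 - 1 / h)"
      by (simp add: sum_distrib_right mult.assoc)
    finally have "moment N h A powr (1 / h) * moment N h A powr (1 - 1 / h)
      \<le> ?c * ?R * moment N h A powr (1 - 1 / h)"
      using K by (simp flip: powr_add)
    then show ?thesis using K by simp
  qed
qed

text \<open>Each prime of \<open>P\<close> splits the set into fibres, which the remaining primes
  separate. A split costs one factor \<open>2h^2 - h\<close>, while the fibre sizes add up to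
  \<open>card A\<close>.\<close>

lemma moment_root_le_of_separating:
  assumes h: "h \<ge> 2" and "finite P"
    and "finite A" "\<forall>a\<in>A. 0 < a" "\<And>a. a \<in> A \<Longrightarrow> 2 * h * a < N"
    and "\<And>a b. a \<in> A \<Longrightarrow> b \<in> A \<Longrightarrow> (\<forall>p\<in>P. expvec a p = expvec b p) \<Longrightarrow> a = b"
  shows "moment N h A powr (1 / h) \<le> (2 * real h ^ 2 - real h) ^ card P * real (card A) * real N powr (1 / h)"
  using assms(2-)
proof (induction P arbitrary: A rule: finite_induct)
  case empty
  have "a = b" if "a \<in> A" "b \<in> A" for a b
    using empty.prems(4)[OF that] by simp
  \<comment> \<open>At most one point is left; a single exponential has modulus 1 and moment
    \<open>N\<close>.\<close>
  then consider "A = {}" | a where "A = {a}" by auto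
  then show ?case by cases (use h in \<open>auto simp: moment_def expsum_def\<close>)
next
  case (insert p P)
  let ?c = "2 * real h ^ 2 - real h"
  let ?V = "(\<lambda>a. expvec a p) ` A"
  let ?Aj = "\<lambda>j. {a \<in> A. expvec a p = j}"
  have c: "?c \<ge> 0" using h by (simp add: power2_eq_square mult_le_cancel_right1)
  have IH: "moment N h (?Aj j) powr (1 / h) \<le> ?c ^ card P * real (card (?Aj j)) * real N powr (1 / h)" for j
    using insert.prems by (intro insert.IH) auto
  have "moment N h A powr (1 / h) \<le> ?c * (\<Sum>j\<in>?V. moment N h (?Aj j) powr (1 / h))"
    using insert.prems h by (intro moment_root_le_fibres) auto
  also have "\<dots> \<le> ?c * (\<Sum>j\<in>?V. ?c ^ card P * real (card (?Aj j)) * real N powr (1 / h))"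
    using c by (intro mult_left_mono sum_mono IH) auto
  also have "\<dots> = ?c ^ Suc (card P) * real (\<Sum>j\<in>?V. card (?Aj j)) * real N powr (1 / h)"
    by (simp add: sum_distrib_left sum_distrib_right mult_ac)
  also have "(\<Sum>j\<in>?V. card (?Aj j)) = card A"
    using insert.prems(1) sum.image_gen[of A "\<lambda>_. 1 :: nat" "\<lambda>a. expvec a p"] by simp
  finally show ?case using insert.hyps by simp
qed

section \<open>Lower bounds for sumsets\<close>

lemma hfold_sumset_eq_image:
  "hfold_sumset h A = (\<lambda>f. \<Sum>i<h. f i) ` PiE {..<h} (\<lambda>_. A)"
proof -
  have "hfold_sumset h A = {sum s {..<h} | s. \<forall>i. i \<in> {..<h} \<longrightarrow> s i \<in> A}"
    unfolding hfold_sumset_def by (subst set_sum_alt) auto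
  also have "\<dots> = (\<lambda>f. \<Sum>i<h. f i) ` PiE {..<h} (\<lambda>_. A)"
  proof safe
    fix s assume "\<forall>i. i \<in> {..<h} \<longrightarrow> s i \<in> A"
    then show "sum s {..<h} \<in> (\<lambda>f. \<Sum>i<h. f i) ` PiE {..<h} (\<lambda>_. A)"
      by (intro image_eqI[of _ _ "restrict s {..<h}"]) auto
  qed blast
  finally show ?thesis .
qed

text \<open>Cauchy-Schwarz for the representation counts \<open>card (r s)\<close>: they sum to
  \<open>card A ^ h\<close>, and their squares count pairs of \<open>h\<close>-tuples with equal
  sum, that is, solutions.\<close>

lemma card_power_le_sumset_solutions:
  fixes A :: "nat set"
  assumes fin: "finite A"
  shows "real (card A) ^ (2 * h) \<le> real (card (hfold_sumset h A)) * real (card (solutions h (\<lambda>_. A)))"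
proof -
  define T where "T = PiE {..<h} (\<lambda>_. A)"
  define S where "S = hfold_sumset h A"
  let ?\<sigma> = "\<lambda>f. \<Sum>i<h. f i"
  define r where "r = (\<lambda>s. {f \<in> T. ?\<sigma> f = s})"
  have finT: "finite T" unfolding T_def using fin by (auto intro: finite_PiE)
  have ST: "S = ?\<sigma> ` T" unfolding S_def T_def by (rule hfold_sumset_eq_image)
  have finS: "finite S" using finT ST by simp
  have "card T = card A ^ h" by (simp add: T_def card_PiE)
  moreover have "card T = (\<Sum>s\<in>S. card (r s))"
    unfolding ST r_def using finT sum.image_gen[of T "\<lambda>_. 1 :: nat" ?\<sigma>] by simp
  ultimately have "real (card A) ^ h = (\<Sum>s\<in>S. real (card (r s)))"
    by (metis of_nat_power of_nat_sum)
  then have "real (card A) ^ (2 * h) = (\<Sum>s\<in>S. 1 * real (card (r s))) ^ 2"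
    by (simp only: mult_1 power_mult[symmetric] mult.commute[of 2 h]) (simp add: power_mult)
  also have "\<dots> \<le> (\<Sum>s\<in>S. 1 ^ 2) * (\<Sum>s\<in>S. (real (card (r s))) ^ 2)"
    by (rule Cauchy_Schwarz_ineq_sum)
  also have "(\<Sum>s\<in>S. (real (card (r s))) ^ 2) = real (card (SIGMA s:S. r s \<times> r s))"
    using finS finT by (subst card_SigmaI) (auto simp: r_def power2_eq_square card_cartesian_product)
  also have "card (SIGMA s:S. r s \<times> r s) \<le> card (solutions h (\<lambda>_. A))"
  proof (rule card_inj_on_le)
    \<comment> \<open>\<open>\<phi>\<close> glues two \<open>h\<close>-tuples;
      \<open>undefined\<close> from \<open>2 * h\<close> on keeps the result in \<open>PiE\<close>.
      The component \<open>s\<close> is recovered as the common sum.\<close>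
    define \<phi> where "\<phi> = (\<lambda>(s :: nat, f, g) i. if i < h then f i else if i < 2 * h then g (i - h) else undefined :: nat)"
    show "inj_on \<phi> (SIGMA s:S. r s \<times> r s)"
    proof (rule inj_onI)
      fix w w' assume w: "w \<in> (SIGMA s:S. r s \<times> r s)" "w' \<in> (SIGMA s:S. r s \<times> r s)"
        and eq': "\<phi> w = \<phi> w'"
      obtain s f g s' f' g' where w_eq: "w = (s, f, g)" "w' = (s', f', g')" by (metis prod_cases3)
      have eq: "\<phi> (s, f, g) = \<phi> (s', f', g')" using eq' w_eq by simp
      have in': "f \<in> r s" "g \<in> r s" "f' \<in> r s'" "g' \<in> r s'" using w w_eq by auto
      then have PE: "f \<in> PiE {..<h} (\<lambda>_. A)" "f' \<in> PiE {..<h} (\<lambda>_. A)"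
        "g \<in> PiE {..<h} (\<lambda>_. A)" "g' \<in> PiE {..<h} (\<lambda>_. A)"
        by (auto simp: r_def T_def)
      have "f = f'"
      proof (rule PiE_ext[OF PE(1,2)])
        fix i assume "i \<in> {..<h}"
        then show "f i = f' i" using fun_cong[OF eq, of i] by (simp add: \<phi>_def)
      qed
      moreover have "g = g'"
      proof (rule PiE_ext[OF PE(3,4)])
        fix i assume "i \<in> {..<h}"
        then show "g i = g' i" using fun_cong[OF eq, of "i + h"] by (simp add: \<phi>_def)
      qed
      ultimately show "w = w'" using in' w_eq by (auto simp: r_def)
    qed
    show "\<phi> ` (SIGMA s:S. r s \<times> r s) \<subseteq> solutions h (\<lambda>_. A)"
    proof clarify
      fix s f g assume "f \<in> r s" "g \<in> r s"
      then have T: "f \<in> PiE {..<h} (\<lambda>_. A)" "g \<in> PiE {..<h} (\<lambda>_. A)" and eq: "?\<sigma> f = ?\<sigma> g"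
        by (auto simp: r_def T_def)
      let ?F = "\<phi> (s, f, g)"
      have "?F \<in> PiE {..<2 * h} (\<lambda>_. A)"
        using T by (auto simp: \<phi>_def PiE_iff extensional_def)
      moreover have "(\<Sum>i<2 * h. possign h i * int (?F i)) = 0"
      proof -
        have split: "(\<Sum>i<m + n. G i) = (\<Sum>i<m. G i) + (\<Sum>i<n. G (i + m))" for G :: "nat \<Rightarrow> int" and m n
          by (induction n) (auto simp: add_ac)
        have "(\<Sum>i<2 * h. possign h i * int (?F i))
          = (\<Sum>i<h. possign h i * int (?F i)) + (\<Sum>i<h. possign h (i + h) * int (?F (i + h)))"
          unfolding mult_2 by (rule split)
        also have "\<dots> = (\<Sum>i<h. int (f i)) + (\<Sum>i<h. - int (g i))"
          by (intro arg_cong2[where f = "(+)"] sum.cong) (auto simp: possign_def \<phi>_def)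
        also have "\<dots> = int (?\<sigma> f) - int (?\<sigma> g)" by (simp add: sum_negf)
        finally show ?thesis using eq by simp
      qed
      ultimately show "?F \<in> solutions h (\<lambda>_. A)" by (simp add: solutions_def)
    qed
  qed (use fin in \<open>auto intro: finite_solutions\<close>)
  finally show ?thesis unfolding S_def by (simp add: mult_left_mono)
qed

text \<open>The \<open>h\<close>-th power of the norm bound, divided by \<open>N\<close>, bounds the
  number of solutions from above; Cauchy-Schwarz then applies.\<close>

lemma card_sumset_ge_of_separating:
  assumes h: "h \<ge> 2" and P: "finite P"
    and A: "finite A" "A \<noteq> {}" "\<forall>a\<in>A. 0 < a"
    and sep: "\<And>a b. a \<in> A \<Longrightarrow> b \<in> A \<Longrightarrow> (\<forall>p\<in>P. expvec a p = expvec b p) \<Longrightarrow> a = b"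
  shows "real (card A) ^ h \<le> ((2 * real h ^ 2 - real h) ^ card P) ^ h * real (card (hfold_sumset h A))"
proof -
  let ?c = "2 * real h ^ 2 - real h"
  \<comment> \<open>Large enough that a signed sum divisible by \<open>N\<close> is 0.\<close>
  define N where "N = Suc (2 * h * Max A)"
  have bd: "2 * h * a < N" if "a \<in> A" for a
    unfolding N_def using Max_ge[OF A(1) that] by (simp add: less_Suc_eq_le)
  have c: "?c \<ge> 0" using h by (simp add: power2_eq_square mult_le_cancel_right1)
  have n: "real (card A) > 0" using A by (simp add: card_gt_0_iff)
  have N: "real N > 0" unfolding N_def by (simp only: of_nat_0_less_iff)
  have nn: "moment N h A \<ge> 0" unfolding moment_def by (intro sum_nonneg) auto
  have root: "(x powr (1 / h)) ^ h = x" if "x \<ge> 0" for x :: real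
    using that h by (cases "x = 0") (auto simp: powr_powr simp flip: powr_realpow)
  have "moment N h A = (moment N h A powr (1 / h)) ^ h" using nn root by simp
  also have "\<dots> \<le> (?c ^ card P * real (card A) * real N powr (1 / h)) ^ h"
    by (intro power_mono moment_root_le_of_separating) (use h P A bd sep in auto)
  also have "\<dots> = (?c ^ card P) ^ h * real (card A) ^ h * real N"
    using N by (simp add: power_mult_distrib root)
  finally have "real N * real (card (solutions h (\<lambda>_. A))) \<le> real N * ((?c ^ card P) ^ h * real (card A) ^ h)"
    using h A bd by (subst (asm) moment_eq_card_solutions) (auto simp: mult_ac)
  then have sol: "real (card (solutions h (\<lambda>_. A))) \<le> (?c ^ card P) ^ h * real (card A) ^ h"
    using N by simp
  have "real (card A) ^ h * real (card A) ^ h = real (card A) ^ (2 * h)"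
    by (simp add: mult_2 power_add)
  also have "\<dots> \<le> real (card (hfold_sumset h A)) * real (card (solutions h (\<lambda>_. A)))"
    using A by (intro card_power_le_sumset_solutions)
  also have "\<dots> \<le> real (card (hfold_sumset h A)) * ((?c ^ card P) ^ h * real (card A) ^ h)"
    by (intro mult_left_mono sol) auto
  finally have "real (card A) ^ h * real (card A) ^ h
    \<le> ((?c ^ card P) ^ h * real (card (hfold_sumset h A))) * real (card A) ^ h"
    by (simp add: mult_ac)
  then show ?thesis using n by simp
qed

section \<open>Small sets and the final comparison\<close>

lemma card_le_card_hfold_sumset:
  fixes A :: "nat set"
  assumes "finite A" "h > 0"
  shows "card A \<le> card (hfold_sumset h A)"
proof (rule card_inj_on_le)
  show "inj_on (\<lambda>a. h * a) A" using assms(2) by (auto simp: inj_on_def)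
  show "(\<lambda>a. h * a) ` A \<subseteq> hfold_sumset h A"
  proof
    fix x assume "x \<in> (\<lambda>a. h * a) ` A"
    then obtain a where "a \<in> A" "x = h * a" by blast
    then show "x \<in> hfold_sumset h A"
      unfolding hfold_sumset_eq_image by (intro image_eqI[of _ _ "\<lambda>i\<in>{..<h}. a"]) auto
  qed
  show "finite (hfold_sumset h A)"
    unfolding hfold_sumset_eq_image using assms(1) by (auto intro: finite_PiE)
qed

text \<open>Turns the quadratic size bound from Freiman's lemma into a power of 6, the value of
  \<open>2h^2 - h\<close> at \<open>h = 2\<close>.\<close>

lemma triangular_le_power: "Suc d * (d + 2) \<le> 2 * 6 ^ d"
proof (induction d)
  case (Suc d)
  have "Suc (Suc d) * (Suc d + 2) \<le> 6 * (Suc d * (d + 2))" by (simp add: algebra_simps)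
  also have "\<dots> \<le> 6 * (2 * 6 ^ d)" using Suc by (intro mult_left_mono) auto
  finally show ?case by simp
qed simp

text \<open>Either the rank is below \<alpha> and fewer than \<alpha> primes separate
  \<open>A\<close>, or Freiman's lemma leaves room only for small \<open>A\<close>, where |hA| \<ge>
  |A| is enough.\<close>

lemma sumset_bound:
  fixes A :: "nat set" and \<alpha> :: real
  assumes A: "finite A" "\<forall>a\<in>A. 0 < a"
    and \<alpha>: "\<alpha> > 0"
    and small: "real (card (A * A)) < \<alpha> * real (card A)"
    and h: "h \<ge> 2"
  shows "(2 * real h ^ 2 - real h) powr (- (real h * \<alpha>)) * real (card A) ^ h < real (card (hfold_sumset h A))"
proof -
  let ?c = "2 * real h ^ 2 - real h"
  have ne: "A \<noteq> {}" using small by auto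
  then have n: "real (card A) \<ge> 1" using A by (simp add: Suc_le_eq card_gt_0_iff)
  have c6: "?c \<ge> 6"
  proof -
    have "2 * 3 \<le> real h * (2 * real h - 1)" using h by (intro mult_mono) auto
    then show ?thesis by (simp add: power2_eq_square algebra_simps)
  qed
  \<comment> \<open>Serves twice: it makes |hA| positive, which keeps the first case strict, and it
    is the lower bound for small \<open>A\<close>.\<close>
  have hA: "real (card A) \<le> real (card (hfold_sumset h A))"
    using card_le_card_hfold_sumset[of A h] A h by simp
  have "real (card A) ^ h < ?c powr (real h * \<alpha>) * real (card (hfold_sumset h A))"
  proof (cases "\<exists>P. finite P \<and> determines P (expdiffs A) \<and> real (card P) < \<alpha>")
    case True
    then obtain P where P: "finite P" "determines P (expdiffs A)" "real (card P) < \<alpha>" by blast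
    have sep: "a = b" if ab: "a \<in> A" "b \<in> A" "\<forall>p\<in>P. expvec a p = expvec b p" for a b
    proof (rule expvec_inj)
      fix p
      have "(\<lambda>p. expvec a p - expvec b p) \<in> zspan (expdiffs A)"
        using ab by (intro zspan.base expdiffsI)
      then show "expvec a p = expvec b p"
        using P(2) ab(3) unfolding determines_def by force
    qed (use A ab in auto)
    have "real (card A) ^ h \<le> (?c ^ card P) ^ h * real (card (hfold_sumset h A))"
      using h P A ne sep by (intro card_sumset_ge_of_separating) auto
    also have "(?c ^ card P) ^ h = ?c powr (real h * real (card P))"
      using c6 by (simp add: powr_powr mult.commute flip: powr_realpow)
    also have "\<dots> * real (card (hfold_sumset h A)) < ?c powr (real h * \<alpha>) * real (card (hfold_sumset h A))"
      using P(3) c6 hA n h by (intro mult_strict_right_mono) auto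
    finally show ?thesis .
  next
    case False
    \<comment> \<open>A rank at least \<alpha> is at least the ceiling \<open>d\<close>, while
      \<open>d - 1\<close> stays below \<alpha>, so that \<open>6 ^ (d - 1)\<close> is at most
      \<open>6 powr \<alpha>\<close>.\<close>
    define d where "d = nat \<lceil>\<alpha>\<rceil>"
    have d: "\<alpha> \<le> real d" "real d < \<alpha> + 1" using \<alpha> unfolding d_def by linarith+
    obtain d' where d': "d = Suc d'" using d \<alpha> by (cases d) auto
    have "d \<le> card P" if "finite P" "determines P (expdiffs A)" for P
    proof -
      have "\<alpha> \<le> real (card P)" using False that by force
      then show ?thesis unfolding d_def by linarith
    qed
    then have "2 * (d + 1) * card A \<le> 2 * card (A * A) + d * (d + 1)"
      using A ne by (intro Freiman_multiplicative) auto
    then have "real (2 * (d + 1) * card A) \<le> real (2 * card (A * A) + d * (d + 1))"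
      by (simp only: of_nat_le_iff)
    then have "2 * (real d + 1) * real (card A) < 2 * \<alpha> * real (card A) + real (d * (d + 1))"
      using small by (simp add: algebra_simps)
    moreover have "2 * (\<alpha> + 1) * real (card A) \<le> 2 * (real d + 1) * real (card A)"
      using d by (intro mult_right_mono) auto
    \<comment> \<open>Since \<alpha> \<le> d, the terms with \<open>\<alpha> * card A\<close> cancel
      and only \<open>2 * card A\<close> remains on the left.\<close>
    ultimately have "real (2 * card A) < real (d * (d + 1))"
      by (simp add: algebra_simps)
    then have "2 * card A < d * (d + 1)" by (simp only: of_nat_less_iff)
    then have "2 * card A < Suc d' * (d' + 2)" using d' by simp
    then have "2 * card A < 2 * 6 ^ d'" using triangular_le_power[of d'] by linarith
    then have "real (card A) < real (6 ^ d')" by (simp only: of_nat_less_iff)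
    also have "\<dots> = 6 powr real d'" by (simp add: powr_realpow)
    also have "\<dots> \<le> 6 powr \<alpha>" using d d' by (intro powr_mono) auto
    also have "\<dots> \<le> ?c powr \<alpha>" using c6 \<alpha> by (intro powr_mono2) auto
    finally have lt: "real (card A) < ?c powr \<alpha>" .
    \<comment> \<open>One factor \<open>card A\<close> is kept to be replaced by |hA|; the other
      \<open>h - 1\<close> cost less than \<open>c^(h\<alpha>)\<close>.\<close>
    have "real (card A) ^ h = real (card A) ^ (h - 1) * real (card A)"
      using h by (simp flip: power_Suc2)
    also have "\<dots> < (?c powr \<alpha>) ^ h * real (card A)"
    proof (rule mult_strict_right_mono)
      have "real (card A) ^ (h - 1) \<le> real (card A) ^ h"
        using n by (intro power_increasing) auto
      also have "\<dots> < (?c powr \<alpha>) ^ h" using lt h by (intro power_strict_mono) auto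
      finally show "real (card A) ^ (h - 1) < (?c powr \<alpha>) ^ h" .
    qed (use n in auto)
    also have "\<dots> \<le> (?c powr \<alpha>) ^ h * real (card (hfold_sumset h A))"
      using hA by (intro mult_left_mono) auto
    also have "(?c powr \<alpha>) ^ h = ?c powr (real h * \<alpha>)"
      using c6 by (simp add: powr_powr mult.commute flip: powr_realpow)
    finally show ?thesis .
  qed
  then show ?thesis using c6 by (simp add: powr_minus field_simps)
qed

theorem theorem1:
  fixes A :: "nat set" and \<alpha> :: real
  assumes "finite A"
    and "\<forall>a\<in>A. 0 < a"
    and "\<alpha> > 0"
    and "real (card (A * A)) < \<alpha> * real (card A)"
  shows "real (card (hfold_sumset 2 A)) > 36 powr (- \<alpha>) * real (card A) ^ 2 \<and>
    (\<forall>h::nat. h \<ge> 2 \<longrightarrow>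
      real (card (hfold_sumset h A))
        > (2 * real h ^ 2 - real h) powr (- (real h * \<alpha>)) * real (card A) ^ h)"
proof -
  \<comment> \<open>At \<open>h = 2\<close> the base is 6, and
    \<open>6^(-2\<alpha>) = 36^(-\<alpha>)\<close>.\<close>
  have "(36 :: real) powr (- \<alpha>) = (6 powr 2) powr (- \<alpha>)" by simp
  also have "\<dots> = 6 powr (- (2 * \<alpha>))" by (simp only: powr_powr) simp
  finally show ?thesis
    using sumset_bound[OF assms] sumset_bound[OF assms, of 2] by simp
qed

end
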